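(* Assume the continuum hypothesis ($\mathfrak{c}=\aleph_1$) holds and that there exists a Suslin tree. Then there is a semiselective ideal $\mathcal{I}$ on $\omega$ such that the coideal $\mathcal{I}^{+}$ does not contain any selective ultrafilter.
   Context: An ideal on $\omega$ is a family $\mathcal{I}\subseteq\wp(\omega)$ with $\omega\notin\mathcal{I}$, $[\omega]^{<\omega}\subseteq\mathcal{I}$, closed under subsets and finite unions. Its coideal is $\mathcal{I}^{+}=\wp(\omega)\setminus\mathcal{I}$, and for $Y\in\mathcal{I}^+$, $\mathcal{I}^{+}\restriction Y=\{Z\in\mathcal{I}^+: Z\subseteq Y\}$. A set $\mathcal{D}\subseteq\mathcal{I}^+$ is dense-open on $(\mathcal{I}^+,\subseteq)$ if for every $N\in\mathcal{I}^+$ there is $M\in\mathcal{D}$ with $M\subseteq N$, and whenever $N\in\mathcal{I}^+$, $M\in\mathcal{D}$ and $N\subseteq M$, then $N\in\mathcal{D}$. For $A\subseteq\omega$ and $m\in\omega$, $A/m=\{k\in A: k>m\}$. The ideal $\mathcal{I}$ is semiselective if for every $A\in\mathcal{I}^+$ and every sequence $\{\mathcal{D}_n\}_{n\in\omega}$ of dense-open subsets of $(\mathcal{I}^+,\subseteq)$ there is $D_\infty\in\mathcal{I}^+\restriction A$ with $D_\infty/m\in\mathcal{D}_m$ for all $m\in D_\infty$. A selective ultrafilter is a nonprincipal ultrafilter $\mathcal{U}$ on $\omega$ such that for every partition of $\omega$ into pieces not in $\mathcal{U}$ there is a set in $\mathcal{U}$ meeting each piece in at most one point (equivalently, its dual ideal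 is selective). *)

theory Defs
  imports Main "HOL-Library.Countable_Set" "HOL-Library.Disjoint_Sets"
begin

unbundle cardinal_syntax

section \<open>The continuum hypothesis\<close>

definition continuum_hypothesis :: bool where
  "continuum_hypothesis \<longleftrightarrow> |UNIV :: nat set set| =o cardSuc natLeq"

section \<open>Suslin trees\<close>

text \<open>A tree is given by its reflexive order relation; its underlying set is the field.\<close>

definition tree_order :: "'a rel \<Rightarrow> bool" where
  "tree_order r \<longleftrightarrow>
     Partial_order r \<and> (\<forall>x\<in>Field r. Well_order (Restr r (underS r x)))"

text \<open>
  The ordinal \<open>ht x\<close> of a node is represented by the well-order of its strict predecessors, and an
  ordinal \<open>\<alpha>\<close> by a well-order \<open>w\<close>; the ordinals below \<open>\<alpha>\<close> are then
  the proper initial segments of \<open>w\<close>. The height is \<open>\<alpha>\<close> iff all nodes have \<open>ht\<close> below \<open>\<alpha>\<close>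
  and all levels below \<open>\<alpha>\<close> are nonempty.
\<close>

definition node_height :: "'a rel \<Rightarrow> 'a \<Rightarrow> 'a rel" where
  "node_height r x = Restr r (underS r x)"

definition has_tree_height :: "'a rel \<Rightarrow> 'b rel \<Rightarrow> bool" where
  "has_tree_height r w \<longleftrightarrow>
     (\<forall>x\<in>Field r. node_height r x <o w) \<and>
     (\<forall>a\<in>Field w. \<exists>x\<in>Field r. node_height r x =o Restr w (underS w a))"

definition antichain_in :: "'a rel \<Rightarrow> 'a set \<Rightarrow> bool" where
  "antichain_in r A \<longleftrightarrow>
     A \<subseteq> Field r \<and> (\<forall>x\<in>A. \<forall>y\<in>A. x \<noteq> y \<longrightarrow> (x, y) \<notin> r \<and> (y, x) \<notin> r)"

text \<open>\<^term>\<open>cardSuc natLeq\<close>, being the least uncountable well-order, represents \<open>\<omega>\<^sub>1\<close>.\<close>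

definition suslin_tree :: "'a rel \<Rightarrow> bool" where
  "suslin_tree r \<longleftrightarrow>
     tree_order r \<and>
     has_tree_height r (cardSuc natLeq) \<and>
     (\<forall>C\<in>Chains r. countable C) \<and>
     (\<forall>A. antichain_in r A \<longrightarrow> countable A)"

section \<open>Ideals on the natural numbers\<close>

definition omega_ideal :: "nat set set \<Rightarrow> bool" where
  "omega_ideal I \<longleftrightarrow>
     UNIV \<notin> I \<and>
     (\<forall>F. finite F \<longrightarrow> F \<in> I) \<and>
     (\<forall>X Y. Y \<in> I \<longrightarrow> X \<subseteq> Y \<longrightarrow> X \<in> I) \<and>
     (\<forall>X Y. X \<in> I \<longrightarrow> Y \<in> I \<longrightarrow> X \<union> Y \<in> I)"

definition coideal :: "nat set set \<Rightarrow> nat set set" where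
  "coideal I = UNIV - I"

definition coideal_restr :: "nat set set \<Rightarrow> nat set \<Rightarrow> nat set set" where
  "coideal_restr I Y = {Z \<in> coideal I. Z \<subseteq> Y}"

definition dense_open :: "nat set set \<Rightarrow> nat set set \<Rightarrow> bool" where
  "dense_open I D \<longleftrightarrow>
     D \<subseteq> coideal I \<and>
     (\<forall>N\<in>coideal I. \<exists>M\<in>D. M \<subseteq> N) \<and>
     (\<forall>N\<in>coideal I. \<forall>M\<in>D. N \<subseteq> M \<longrightarrow> N \<in> D)"

definition tail_above :: "nat set \<Rightarrow> nat \<Rightarrow> nat set" where
  "tail_above A m = {k \<in> A. k > m}"

definition semiselective :: "nat set set \<Rightarrow> bool" where
  "semiselective I \<longleftrightarrow>
     omega_ideal I \<and>
     (\<forall>A\<in>coideal I. \<forall>D :: nat \<Rightarrow> nat set set.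
        (\<forall>n. dense_open I (D n)) \<longrightarrow>
        (\<exists>E\<in>coideal_restr I A. \<forall>m\<in>E. tail_above E m \<in> D m))"

section \<open>Selective ultrafilters\<close>

definition omega_ultrafilter :: "nat set set \<Rightarrow> bool" where
  "omega_ultrafilter U \<longleftrightarrow>
     UNIV \<in> U \<and> {} \<notin> U \<and>
     (\<forall>X Y. X \<in> U \<longrightarrow> X \<subseteq> Y \<longrightarrow> Y \<in> U) \<and>
     (\<forall>X Y. X \<in> U \<longrightarrow> Y \<in> U \<longrightarrow> X \<inter> Y \<in> U) \<and>
     (\<forall>X. X \<in> U \<or> - X \<in> U)"

definition selective_ultrafilter :: "nat set set \<Rightarrow> bool" where
  "selective_ultrafilter U \<longleftrightarrow>
     omega_ultrafilter U \<and>
     (\<nexists>n. U = {X. n \<in> X}) \<and>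
     (\<forall>P. partition_on UNIV P \<longrightarrow> P \<inter> U = {} \<longrightarrow>
        (\<exists>S\<in>U. \<forall>p\<in>P. \<forall>x\<in>S \<inter> p. \<forall>y\<in>S \<inter> p. x = y))"

end

theory Submission
  imports Defs "HOL-Library.Countable_Set_Type"
begin

text \<open>Embed the Suslin tree into the infinite sets of naturals so that the sets \<open>A t\<close> decrease
  modulo finite along the tree order and are almost disjoint at incomparable nodes. CH lets the
  construction treat every set of naturals and every function at some level: densely many \<open>A t\<close>
  decide a given set, and grow faster than a given function. The coideal consists of the sets
  almost containing some \<open>A t\<close> with \<open>t\<close> having uncountably many extensions. It is a coideal because
  every set is decided densely often, and it is semiselective because the tree is
  \<open>\<omega>\<close>-distributive and the \<open>A t\<close> can be made sparse. A selective ultrafilter contained in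
  it would, by selectivity applied to the countable almost disjoint family of a level, contain some
  \<open>A t\<close> at each level, and these nodes would form an uncountable chain.\<close>

section \<open>The first uncountable ordinal\<close>

abbreviation omega1 :: "nat set rel" where
  "omega1 \<equiv> cardSuc natLeq"

lemma Card_order_omega1: "Card_order omega1"
  by (rule cardSuc_Card_order[OF natLeq_Card_order])

lemma Well_order_omega1: "Well_order omega1"
  using Card_order_omega1 card_order_on_well_order_on by blast

lemma countable_underS_omega1:
  assumes "a \<in> Field omega1"
  shows "countable (underS omega1 a)"
  using card_of_underS[OF Card_order_omega1 assms]
    cardSuc_ordLeq_ordLess[OF natLeq_Card_order card_of_Card_order]
  unfolding countable_card_le_natLeq by blast

lemma uncountable_Field_omega1: "uncountable (Field omega1)"
proof
  assume "countable (Field omega1)"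
  then have "|Field omega1| \<le>o natLeq"
    unfolding countable_card_le_natLeq .
  then have "omega1 \<le>o natLeq"
    using card_of_Field_ordIso[OF Card_order_omega1] ordIso_ordLeq_trans ordIso_symmetric by blast
  then show False
    using cardSuc_greater[OF natLeq_Card_order] not_ordLess_ordLeq by blast
qed

text \<open>Of two distinct initial segments one lies properly inside the other and is strictly
  shorter. Hence the height of a node, an isomorphism type, corresponds to a single element of
  \<open>omega1\<close>.\<close>

lemma omega1_initial_segment_unique:
  assumes "a \<in> Field omega1" "b \<in> Field omega1"
    and iso: "Restr omega1 (underS omega1 a) =o Restr omega1 (underS omega1 b)"
  shows "a = b"
proof -
  have False
    if ab: "a \<in> Field omega1" "b \<in> Field omega1" "a \<noteq> b" "(a, b) \<in> omega1"
      and iso: "Restr omega1 (underS omega1 a) =o Restr omega1 (underS omega1 b)" for a b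
  proof -
    have po: "trans omega1" "antisym omega1"
      using Well_order_omega1 unfolding order_on_defs by auto
    have "underS omega1 a \<subset> underS omega1 b"
    proof
      show "underS omega1 a \<subseteq> underS omega1 b"
        using po ab unfolding underS_def by (auto dest: transD antisymD)
      show "underS omega1 a \<noteq> underS omega1 b"
        using ab unfolding underS_def by auto
    qed
    then have "Restr omega1 (underS omega1 a) <o Restr omega1 (underS omega1 b)"
      using ofilter_subset_ordLess[OF Well_order_omega1] Well_order_omega1
      by (simp add: wo_rel.underS_ofilter wo_rel_def)
    then show False
      using iso not_ordLess_ordIso by blast
  qed
  then show ?thesis
    using assms ordIso_symmetric[OF iso] wo_rel.TOTALS[of omega1] Well_order_omega1
    unfolding wo_rel_def by metis
qed

section \<open>Suslin trees as forcing notions\<close>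

locale suslin =
  fixes r :: "'a rel"
  assumes suslin: "suslin_tree r"
begin

lemma partial_order: "Partial_order r"
  using suslin unfolding suslin_tree_def tree_order_def by blast

lemma refl: "x \<in> Field r \<Longrightarrow> (x, x) \<in> r"
  by (rule refl_onD[OF partial_order_onD(1)[OF partial_order]])

lemma trans: "(x, y) \<in> r \<Longrightarrow> (y, z) \<in> r \<Longrightarrow> (x, z) \<in> r"
  by (rule transD[OF partial_order_onD(2)[OF partial_order]])

lemma antisym: "(x, y) \<in> r \<Longrightarrow> (y, x) \<in> r \<Longrightarrow> x = y"
  by (rule antisymD[OF partial_order_onD(3)[OF partial_order]])

lemma Well_order_node_height: "x \<in> Field r \<Longrightarrow> Well_order (node_height r x)"
  using suslin unfolding suslin_tree_def tree_order_def node_height_def by blast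

lemma Field_node_height: "Field (node_height r x) = underS r x"
proof -
  have "underS r x \<subseteq> Field r"
    unfolding underS_def Field_def by blast
  then show ?thesis
    unfolding node_height_def using Refl_Field_Restr2 partial_order_onD(1)[OF partial_order] by blast
qed

lemma linear_below:
  assumes "(y, x) \<in> r" "(z, x) \<in> r"
  shows "(y, z) \<in> r \<or> (z, y) \<in> r"
proof (cases "y = x \<or> z = x")
  case False
  then have yz: "y \<in> underS r x" "z \<in> underS r x"
    using assms unfolding underS_def by auto
  have "total_on (underS r x) (node_height r x)"
    using Well_order_node_height[of x] assms Field_node_height FieldI2
    unfolding well_order_on_def linear_order_on_def by metis
  with yz show ?thesis
    using refl assms unfolding total_on_def node_height_def by (metis FieldI1 IntD1)
qed (use assms in auto)

text \<open>\<open>underS r x\<close> is downward closed, so a minimum of \<open>Q\<close> inside it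
  is minimal in all of \<open>Q\<close>. This licenses induction and recursion along the
  tree.\<close>

lemma wf_strict: "wf (r - Id)"
proof (rule wfI_min)
  fix x Q assume xQ: "x \<in> (Q :: 'a set)"
  show "\<exists>z\<in>Q. \<forall>y. (y, z) \<in> r - Id \<longrightarrow> y \<notin> Q"
  proof (cases "\<exists>y\<in>Q. y \<in> underS r x")
    case True
    then obtain y where y: "y \<in> Q" "y \<in> underS r x" by blast
    then have "x \<in> Field r" unfolding underS_def by (auto intro: FieldI2)
    then have "wf (node_height r x - Id)"
      using Well_order_node_height unfolding well_order_on_def by blast
    then obtain z where z: "z \<in> Q \<inter> underS r x"
      "\<And>u. (u, z) \<in> node_height r x - Id \<Longrightarrow> u \<notin> Q \<inter> underS r x"
      using y wfE_min[of _ y "Q \<inter> underS r x"] by blast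
    have "u \<notin> Q" if u: "(u, z) \<in> r - Id" for u
    proof -
      have "u \<in> underS r x"
        using u z(1) trans antisym unfolding underS_def by blast
      then show ?thesis
        using z u unfolding node_height_def by blast
    qed
    then show ?thesis using z by blast
  next
    case False
    then show ?thesis using xQ unfolding underS_def by blast
  qed
qed

lemma countable_chain: "C \<in> Chains r \<Longrightarrow> countable C"
  using suslin unfolding suslin_tree_def by blast

lemma countable_antichain: "antichain_in r C \<Longrightarrow> countable C"
  using suslin unfolding suslin_tree_def by blast

lemma countable_below: "countable {y. (y, x) \<in> r}"
  by (rule countable_chain) (use linear_below in \<open>auto simp: Chains_def\<close>)

section \<open>Heights and levels of nodes\<close>

lemma node_height_below:
  assumes "(x, y) \<in> r" "x \<noteq> y"
  shows "node_height r x = Restr (node_height r y) (underS (node_height r y) x)"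
proof -
  have "underS (node_height r y) x = underS r x" "underS r x \<subseteq> underS r y"
    using assms trans antisym unfolding node_height_def underS_def by blast+
  then show ?thesis
    unfolding node_height_def by auto
qed

text \<open>Naming heights by elements of \<open>omega1\<close> lets equality define the levels, and
  lets an enumeration along \<open>Field omega1\<close> assign one task to each level.\<close>

definition ht :: "'a \<Rightarrow> nat set" where
  "ht x = (SOME a. a \<in> Field omega1 \<and> node_height r x =o Restr omega1 (underS omega1 a))"

lemma ht:
  assumes "x \<in> Field r"
  shows "ht x \<in> Field omega1" "node_height r x =o Restr omega1 (underS omega1 (ht x))"
proof -
  have "node_height r x <o omega1"
    using suslin assms unfolding suslin_tree_def has_tree_height_def by blast
  then have "\<exists>a. a \<in> Field omega1 \<and> node_height r x =o Restr omega1 (underS omega1 a)"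
    using ordLess_iff_ordIso_Restr[OF Well_order_omega1 Well_order_node_height[OF assms]] by blast
  from someI_ex[OF this]
  show "ht x \<in> Field omega1" "node_height r x =o Restr omega1 (underS omega1 (ht x))"
    unfolding ht_def by blast+
qed

lemma ht_unique:
  assumes "x \<in> Field r" "a \<in> Field omega1" "node_height r x =o Restr omega1 (underS omega1 a)"
  shows "ht x = a"
  using ht[OF assms(1)] assms omega1_initial_segment_unique ordIso_symmetric ordIso_transitive
  by metis

lemma ht_cong: "underS r x = underS r y \<Longrightarrow> ht x = ht y"
  unfolding ht_def node_height_def by simp

text \<open>The height of a strict predecessor is a proper initial segment of the other height. This
  makes each level an antichain.\<close>

lemma ht_neq:
  assumes "(x, y) \<in> r" "x \<noteq> y"
  shows "ht x \<noteq> ht y"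
proof
  assume eq: "ht x = ht y"
  have xy: "x \<in> Field r" "y \<in> Field r" using assms by (auto intro: FieldI1 FieldI2)
  have "Field (node_height r y) \<noteq> {}"
    using assms unfolding Field_node_height underS_def by blast
  then have "node_height r x <o node_height r y"
    using underS_Restr_ordLess[OF Well_order_node_height[OF xy(2)]] node_height_below[OF assms]
    by simp
  moreover have "node_height r x =o node_height r y"
    using ht(2)[OF xy(1)] ht(2)[OF xy(2)] eq ordIso_symmetric ordIso_transitive by metis
  ultimately show False
    using not_ordLess_ordIso by blast
qed

lemma countable_level: "countable {x \<in> Field r. ht x = a}"
  by (rule countable_antichain) (auto simp: antichain_in_def dest: ht_neq)

lemma ht_surj:
  assumes "a \<in> Field omega1"
  shows "\<exists>x\<in>Field r. ht x = a"
proof -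
  obtain x where "x \<in> Field r" "node_height r x =o Restr omega1 (underS omega1 a)"
    using suslin assms unfolding suslin_tree_def has_tree_height_def by blast
  then show ?thesis using ht_unique assms by blast
qed

lemma uncountable_Field: "uncountable (Field r)"
proof
  assume "countable (Field r)"
  then have "countable (ht ` Field r)" by simp
  moreover have "Field omega1 \<subseteq> ht ` Field r" using ht_surj by blast
  ultimately show False using uncountable_Field_omega1 countable_subset by blast
qed

text \<open>If \<open>ht y\<close> is not below \<open>a\<close>, then \<open>a\<close> is
  \<open>ht y\<close> or lies strictly below it; in the latter case the initial segment of
  \<open>a\<close> is transferred to the predecessors of \<open>y\<close> and determines the
  node.\<close>

lemma ht_below:
  assumes y: "y \<in> Field r" and a: "a \<in> Field omega1" and notin: "ht y \<notin> underS omega1 a"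
  shows "\<exists>z. (z, y) \<in> r \<and> ht z = a"
proof (cases "ht y = a")
  case True
  then show ?thesis using y refl by blast
next
  case False
  have wo: "wo_rel omega1" using Well_order_omega1 unfolding wo_rel_def .
  have "(a, ht y) \<in> omega1"
    using wo_rel.TOTALS[OF wo] a ht(1)[OF y] notin False unfolding underS_def by blast
  then have "underS omega1 a \<subset> underS omega1 (ht y)"
    using wo_rel.TRANS[OF wo] wo_rel.ANTISYM[OF wo] False unfolding underS_def
    by (auto dest: transD antisymD)
  then have "Restr omega1 (underS omega1 a) <o Restr omega1 (underS omega1 (ht y))"
    using ofilter_subset_ordLess[OF Well_order_omega1] wo_rel.underS_ofilter[OF wo] by blast
  then have "Restr omega1 (underS omega1 a) <o node_height r y"
    using ht(2)[OF y] ordIso_symmetric ordLess_ordIso_trans by blast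
  then obtain z where z: "z \<in> Field (node_height r y)"
    "Restr omega1 (underS omega1 a) =o Restr (node_height r y) (underS (node_height r y) z)"
    using ordLess_iff_ordIso_Restr[OF Well_order_node_height[OF y]
        Well_order_Restr[OF Well_order_omega1]] by blast
  then have zy: "(z, y) \<in> r" "z \<noteq> y"
    unfolding Field_node_height underS_def by auto
  have "node_height r z =o Restr omega1 (underS omega1 a)"
    using z(2) node_height_below[OF zy] ordIso_symmetric by simp
  then show ?thesis
    using ht_unique[OF _ a] zy FieldI1 by metis
qed

section \<open>Nodes with uncountably many extensions\<close>

definition big :: "'a set" where
  "big = {x \<in> Field r. uncountable {y. (x, y) \<in> r}}"

lemma big_Field: "x \<in> big \<Longrightarrow> x \<in> Field r"
  unfolding big_def by blast

text \<open>The minimal nodes outside \<open>big\<close> form a countable antichain. Each has only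
  countably many extensions, and these extensions cover the complement of
  \<open>big\<close>.\<close>

lemma countable_not_big: "countable (Field r - big)"
proof -
  define M where "M = {x \<in> Field r - big. \<forall>y. (y, x) \<in> r - Id \<longrightarrow> y \<in> big}"
  have "antichain_in r M"
    unfolding antichain_in_def M_def by blast
  then have "countable M" by (rule countable_antichain)
  then have "countable (\<Union>x\<in>M. {y. (x, y) \<in> r})"
    by (rule countable_UN) (auto simp: M_def big_def)
  moreover have "Field r - big \<subseteq> (\<Union>x\<in>M. {y. (x, y) \<in> r})"
  proof
    fix y assume y: "y \<in> Field r - big"
    then have "y \<in> {x. (x, y) \<in> r \<and> x \<notin> big}" using refl by blast
    from wfE_min[OF wf_strict this] obtain z where
      z: "(z, y) \<in> r" "z \<notin> big" "\<And>u. (u, z) \<in> r - Id \<Longrightarrow> u \<notin> {x. (x, y) \<in> r \<and> x \<notin> big}"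
      by blast
    then have "z \<in> M"
      unfolding M_def using trans FieldI1 by fastforce
    with z show "y \<in> (\<Union>x\<in>M. {y. (x, y) \<in> r})" by blast
  qed
  ultimately show ?thesis using countable_subset by blast
qed

lemma big_nonempty: "big \<noteq> {}"
  using countable_not_big uncountable_Field by auto

lemma big_extension_avoiding:
  assumes x: "x \<in> big" and C: "countable C"
  shows "\<exists>y\<in>big. (x, y) \<in> r \<and> y \<notin> C"
proof (rule ccontr)
  assume "\<not> ?thesis"
  then have "{y. (x, y) \<in> r} \<subseteq> C \<union> (Field r - big)"
    using FieldI2 by fastforce
  then have "countable {y. (x, y) \<in> r}"
    using C countable_not_big countable_subset countable_Un by metis
  then show False using x unfolding big_def by blast
qed

text \<open>Only countably many nodes have height below \<open>a\<close>, so some extension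
  \<open>y\<close> in \<open>big\<close> avoids them. The node \<open>z\<close> of height
  \<open>a\<close> below \<open>y\<close> need not lie above \<open>x\<close>.\<close>

lemma big_extension_to_level:
  assumes x: "x \<in> big" and a: "a \<in> Field omega1"
  shows "\<exists>y\<in>big. (x, y) \<in> r \<and> (\<exists>z. (z, y) \<in> r \<and> ht z = a)"
proof -
  have "countable (\<Union>b\<in>underS omega1 a. {x \<in> Field r. ht x = b})"
    using countable_underS_omega1[OF a] countable_level by blast
  from big_extension_avoiding[OF x this] obtain y where
    y: "y \<in> big" "(x, y) \<in> r" "ht y \<notin> underS omega1 a"
    using big_Field by auto
  then show ?thesis
    using ht_below[OF big_Field a] by blast
qed

text \<open>A Suslin tree adds no new countable sequences: a maximal antichain inside each of countably
  many dense open sets is countable, and any node not below one of their members lies in all of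
  the dense open sets.\<close>

lemma big_distributive:
  fixes E :: "nat \<Rightarrow> 'a set"
  assumes x: "x \<in> big"
    and dense: "\<And>n u. u \<in> big \<Longrightarrow> \<exists>v\<in>E n \<inter> big. (u, v) \<in> r"
    and opn: "\<And>n u v. u \<in> E n \<Longrightarrow> v \<in> big \<Longrightarrow> (u, v) \<in> r \<Longrightarrow> v \<in> E n"
  shows "\<exists>y\<in>big. (x, y) \<in> r \<and> (\<forall>n. y \<in> E n)"
proof -
  have "\<exists>M. M \<subseteq> E n \<inter> big \<and> antichain_in r M \<and>
      (\<forall>v\<in>E n \<inter> big. \<exists>m\<in>M. (m, v) \<in> r \<or> (v, m) \<in> r)" for n
  proof -
    define \<A> where "\<A> = {M. M \<subseteq> E n \<inter> big \<and> antichain_in r M}"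
    have "\<Union>C \<in> \<A>" if C: "subset.chain \<A> C" for C
      unfolding \<A>_def mem_Collect_eq antichain_in_def
    proof (intro conjI ballI impI)
      show "\<Union>C \<subseteq> E n \<inter> big" "\<Union>C \<subseteq> Field r"
        using C big_Field unfolding subset.chain_def \<A>_def by blast+
      fix u v assume uv: "u \<in> \<Union>C" "v \<in> \<Union>C" "u \<noteq> v"
      then obtain X where "X \<in> C" "u \<in> X" "v \<in> X"
        using C unfolding subset_chain_def by blast
      then show "(u, v) \<notin> r" "(v, u) \<notin> r"
        using C uv(3) unfolding subset.chain_def \<A>_def antichain_in_def by blast+
    qed
    from subset_Zorn'[OF this] obtain M where M: "M \<in> \<A>" "\<And>X. X \<in> \<A> \<Longrightarrow> M \<subseteq> X \<Longrightarrow> X = M"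
      by blast
    have "\<exists>m\<in>M. (m, v) \<in> r \<or> (v, m) \<in> r" if v: "v \<in> E n \<inter> big" for v
    proof (rule ccontr)
      assume no: "\<not> ?thesis"
      then have "insert v M \<in> \<A>"
        using M(1) v big_Field unfolding \<A>_def antichain_in_def by blast
      with M(2) have "v \<in> M" by blast
      then show False using no refl v big_Field by blast
    qed
    then show ?thesis using M(1) unfolding \<A>_def by blast
  qed
  then obtain M where M: "\<And>n. M n \<subseteq> E n \<inter> big" "\<And>n. antichain_in r (M n)"
    "\<And>n v. v \<in> E n \<inter> big \<Longrightarrow> \<exists>m\<in>M n. (m, v) \<in> r \<or> (v, m) \<in> r"
    by metis
  have "countable (\<Union>n. \<Union>m\<in>M n. {y. (y, m) \<in> r})"
    using countable_antichain[OF M(2)] countable_below by blast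
  from big_extension_avoiding[OF x this] obtain y where
    y: "y \<in> big" "(x, y) \<in> r" "\<And>n m. m \<in> M n \<Longrightarrow> (y, m) \<notin> r"
    by blast
  have "y \<in> E n" for n
  proof -
    \<comment> \<open>\<open>y\<close> is below no member of \<open>M n\<close>, so a member
      comparable with \<open>v\<close> lies below \<open>v\<close>; it is then comparable with
      \<open>y\<close>, hence below \<open>y\<close>.\<close>
    obtain v where v: "v \<in> E n \<inter> big" "(y, v) \<in> r" using dense y(1) by blast
    with M(3) obtain m where m: "m \<in> M n" "(m, v) \<in> r \<or> (v, m) \<in> r" by blast
    then have "(m, v) \<in> r" using y(3) v trans by blast
    then have "(m, y) \<in> r" using linear_below v(2) y(3) m(1) by blast
    then show ?thesis using opn M(1) m(1) y(1) by blast
  qed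
  then show ?thesis using y by blast
qed

end

section \<open>Infinite sets of natural numbers modulo finite\<close>

lemma infinite_almost_subset: "infinite B \<Longrightarrow> finite (B - C) \<Longrightarrow> infinite (B \<inter> C)"
  for B C :: "'b set"
  by (metis Int_Diff_Un finite_Un)

lemma almost_subset_trans: "finite (B - C) \<Longrightarrow> finite (C - D) \<Longrightarrow> finite (B - D)"
  for B C D :: "'b set"
  by (rule finite_subset[of _ "(B - C) \<union> (C - D)"]) auto

lemma finite_imp_bounded: "finite F \<Longrightarrow> \<exists>k. \<forall>n\<in>F. n \<le> k" for F :: "nat set"
  using finite_nat_set_iff_bounded_le by blast

text \<open>Diagonalization: a strictly increasing sequence takes its term \<open>n\<close> from the
  intersection of the sets with index at most \<open>n\<close>, so only finitely many terms miss a
  given set.\<close>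

lemma pseudo_intersection:
  fixes F :: "nat set set"
  assumes "countable F" and inf: "\<And>G. finite G \<Longrightarrow> G \<subseteq> F \<Longrightarrow> infinite (\<Inter>G)"
  shows "\<exists>B. infinite B \<and> (\<forall>X\<in>F. finite (B - X))"
proof (cases "F = {}")
  case True
  then show ?thesis using infinite_UNIV_nat by blast
next
  case False
  define f where "f = from_nat_into F"
  have f: "range f = F" unfolding f_def using False assms(1) by (rule range_from_nat_into)
  define C where "C n = \<Inter>(f ` {..n})" for n
  have C_inf: "infinite (C n)" for n
    unfolding C_def by (rule inf) (use f in auto)
  have "\<exists>b. \<forall>n. b n \<in> C n \<and> b n < (b (Suc n) :: nat)"
  proof (rule dependent_nat_choice)
    show "\<exists>x. x \<in> C 0"
      using C_inf[of 0] by (metis ex_in_conv finite.emptyI)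
    show "\<exists>y. y \<in> C (Suc n) \<and> x < y" for x n
      using C_inf[of "Suc n"] unfolding infinite_nat_iff_unbounded by blast
  qed
  then obtain b where b: "\<And>n. b n \<in> C n" "\<And>n. b n < b (Suc n)" by blast
  have "strict_mono b" using b(2) by (simp add: strict_mono_Suc_iff)
  then have "infinite (range b)"
    using range_inj_infinite strict_mono_imp_inj_on by blast
  moreover have "finite (range b - X)" if X: "X \<in> F" for X
  proof -
    obtain k where k: "X = f k" using f X by blast
    have "range b - X \<subseteq> b ` {..<k}"
    proof
      fix m assume "m \<in> range b - X"
      then obtain n where n: "m = b n" "b n \<notin> f k" using k by blast
      then have "\<not> k \<le> n" using b(1)[of n] unfolding C_def by auto
      then show "m \<in> b ` {..<k}" using n by auto
    qed
    then show ?thesis using finite_surj by blast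
  qed
  ultimately show ?thesis by blast
qed

text \<open>Pairing codes cut \<open>B\<close> into infinitely many infinite pieces at once, so any
  countable family of siblings can receive disjoint sets.\<close>

definition split_set :: "nat set \<Rightarrow> nat \<Rightarrow> nat set" where
  "split_set B n = range (\<lambda>k. enumerate B (prod_encode (n, k)))"

lemma split_set_subset: "infinite B \<Longrightarrow> split_set B n \<subseteq> B"
  unfolding split_set_def using enumerate_in_set by auto

lemma infinite_split_set:
  assumes "infinite B"
  shows "infinite (split_set B n)"
proof -
  have "inj (\<lambda>k. enumerate B (prod_encode (n, k)))"
    by (simp add: inj_def inj_eq[OF inj_enumerate[OF assms]])
  then show ?thesis unfolding split_set_def by (rule range_inj_infinite)
qed

lemma split_set_disjoint:
  assumes "infinite B" "m \<noteq> n"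
  shows "split_set B m \<inter> split_set B n = {}"
  unfolding split_set_def using assms(2) by (auto simp: inj_eq[OF inj_enumerate[OF assms(1)]])

text \<open>Density and openness as in P(omega)/fin. Openness under almost inclusion lets a
  condition met at one node pass to every node above it.\<close>

definition almost_dense_open :: "nat set set \<Rightarrow> bool" where
  "almost_dense_open Q \<longleftrightarrow>
     (\<forall>B. infinite B \<longrightarrow> (\<exists>C\<in>Q. infinite C \<and> C \<subseteq> B)) \<and>
     (\<forall>B\<in>Q. \<forall>C. finite (C - B) \<longrightarrow> C \<in> Q)"

text \<open>Embedding of the tree into the infinite sets ordered by almost inclusion: at a node, a
  pseudo-intersection of the sets at the nodes below it is shrunk into the dense open set of its
  level, and then divided among the nodes having the same predecessors. Successor and limit
  levels need no distinction.\<close>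

lemma (in suslin) tower_exists:
  assumes Q: "\<And>a. almost_dense_open (Q a)"
  shows "\<exists>A. (\<forall>x\<in>Field r. infinite (A x) \<and> A x \<in> Q (ht x)) \<and>
    (\<forall>x y. (x, y) \<in> r \<longrightarrow> finite (A y - A x)) \<and>
    (\<forall>x\<in>Field r. \<forall>y\<in>Field r. (x, y) \<notin> r \<longrightarrow> (y, x) \<notin> r \<longrightarrow> finite (A x \<inter> A y))"
proof -
  define sib where "sib x = {y \<in> Field r. underS r y = underS r x}" for x
  define good where "good g x B \<longleftrightarrow>
    infinite B \<and> B \<in> Q (ht x) \<and> (\<forall>s\<in>underS r x. finite (B - g s))" for g x B
  \<comment> \<open>\<open>good g x\<close> and \<open>sib x\<close> depend only on the predecessors
    of \<open>x\<close>, so siblings get the same set from \<open>Eps\<close>; their indices in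
    \<open>sib x\<close> select different pieces of it.\<close>
  define F where "F g x = split_set (Eps (good g x)) (to_nat_on (sib x) x)" for g x
  define A where "A = wfrec (r - Id) F"
  \<comment> \<open>\<open>good\<close> consults \<open>A\<close> only at strict predecessors, where
    \<open>cut\<close> changes nothing.\<close>
  have "F (cut A (r - Id) x) x = F A x" for x
  proof -
    have "good (cut A (r - Id) x) x = good A x"
      unfolding good_def by (auto simp: underS_def cut_apply)
    then show ?thesis unfolding F_def by simp
  qed
  then have A_eq: "A x = F A x" for x
    using def_wfrec[OF eq_reflection[OF A_def] wf_strict] by metis
  have sib_countable: "countable (sib x)" for x
  proof (rule countable_antichain, unfold antichain_in_def sib_def, safe)
    fix u v assume "underS r u = underS r x" "underS r v = underS r x" "u \<noteq> v"
    then have "u \<notin> underS r v" "v \<notin> underS r u"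
      unfolding underS_def by auto
    then show "(u, v) \<in> r \<Longrightarrow> False" "(v, u) \<in> r \<Longrightarrow> False"
      using \<open>u \<noteq> v\<close> unfolding underS_def by auto
  qed
  define B where "B x = Eps (good A x)" for x
  have A_B: "A x = split_set (B x) (to_nat_on (sib x) x)" for x
    using A_eq[of x] unfolding F_def B_def .
  have A_good: "good A x (A x)" if "good A x (B x)" for x
  proof -
    have B: "infinite (B x)" "B x \<in> Q (ht x)" "\<And>s. s \<in> underS r x \<Longrightarrow> finite (B x - A s)"
      using that unfolding good_def by auto
    have sub: "A x \<subseteq> B x" unfolding A_B using split_set_subset[OF B(1)] .
    then have "A x - B x = {}" by blast
    then have "A x \<in> Q (ht x)" using Q[of "ht x"] B(2) unfolding almost_dense_open_def
      by (metis finite.emptyI)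
    moreover have "infinite (A x)" unfolding A_B using infinite_split_set[OF B(1)] .
    moreover have "finite (A x - A s)" if "s \<in> underS r x" for s
      using B(3)[OF that] sub by (meson Diff_mono finite_subset order_refl)
    ultimately show ?thesis unfolding good_def by blast
  qed
  have good: "x \<in> Field r \<longrightarrow> good A x (B x)" for x
  proof (induction x rule: wf_induct_rule[OF wf_strict])
    case (1 x)
    show ?case
    proof
      assume x: "x \<in> Field r"
      have IH: "good A s (A s)" if "s \<in> underS r x" for s
        using 1[of s] that A_good unfolding underS_def by (auto intro: FieldI1)
      have "\<exists>C. infinite C \<and> (\<forall>X\<in>A ` underS r x. finite (C - X))"
      proof (rule pseudo_intersection)
        have "underS r x \<subseteq> {y. (y, x) \<in> r}" unfolding underS_def by blast
        then show "countable (A ` underS r x)"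
          using countable_below countable_subset by blast
        fix G assume "finite G" "G \<subseteq> A ` underS r x"
        then obtain S where S: "S \<subseteq> underS r x" "finite S" "G = A ` S"
          using finite_subset_image by metis
        \<comment> \<open>A nonempty finite set of nodes below \<open>x\<close> is a chain with a
          greatest element \<open>m\<close>, and \<open>A m\<close> is almost contained in every
          member of \<open>G\<close>.\<close>
        have "S = {} \<or> (\<exists>m\<in>S. \<forall>s\<in>S. (s, m) \<in> r)"
          using S(2,1)
        proof (induction S rule: finite_induct)
          case (insert u S)
          have u: "(u, u) \<in> r" "(u, x) \<in> r"
            using insert.prems refl FieldI1 unfolding underS_def by fastforce+
          show ?case
          proof (cases "S = {}")
            case True
            then show ?thesis using u by blast
          next
            case False
            then obtain m where m: "m \<in> S" "\<forall>s\<in>S. (s, m) \<in> r"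
              using insert by blast
            then have "(m, x) \<in> r" using insert.prems unfolding underS_def by blast
            with u(2) have "(m, u) \<in> r \<or> (u, m) \<in> r" by (rule linear_below[rotated])
            then show ?thesis
            proof
              assume "(m, u) \<in> r"
              then have "\<forall>s\<in>insert u S. (s, u) \<in> r" using m(2) u(1) trans by blast
              then show ?thesis by blast
            qed (use m in blast)
          qed
        qed simp
        then show "infinite (\<Inter>G)"
        proof
          assume "S = {}"
          then show ?thesis using S(3) infinite_UNIV_nat by simp
        next
          assume "\<exists>m\<in>S. \<forall>s\<in>S. (s, m) \<in> r"
          then obtain m where m: "m \<in> S" "\<And>s. s \<in> S \<Longrightarrow> (s, m) \<in> r" by blast
          have gm: "good A m (A m)" using IH m(1) S(1) by blast
          have "finite (A m - A s)" if "s \<in> S" for s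
            using gm m(2)[OF that] unfolding good_def underS_def by (cases "s = m") auto
          then have "finite (\<Union>s\<in>S. A m - A s)" using S(2) by blast
          moreover have "A m - \<Inter>G \<subseteq> (\<Union>s\<in>S. A m - A s)" using S(3) by blast
          ultimately have "finite (A m - \<Inter>G)" using finite_subset by blast
          then show ?thesis
            using gm infinite_almost_subset unfolding good_def by (metis finite_Int)
        qed
      qed
      then obtain C where C: "infinite C" "\<And>s. s \<in> underS r x \<Longrightarrow> finite (C - A s)" by blast
      then obtain D where D: "infinite D" "D \<in> Q (ht x)" "D \<subseteq> C"
        using Q[of "ht x"] unfolding almost_dense_open_def by blast
      have "finite (D - A s)" if "s \<in> underS r x" for s
        using C(2)[OF that] D(3) by (meson Diff_mono finite_subset order_refl)
      then have "good A x D" unfolding good_def using D by blast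
      then show "good A x (B x)" unfolding B_def by (rule someI)
    qed
  qed
  have dec: "finite (A y - A x)" if "(x, y) \<in> r" for x y
  proof (cases "x = y")
    case False
    then have "x \<in> underS r y" using that unfolding underS_def by blast
    moreover have "good A y (A y)" using A_good good that FieldI2 by fast
    ultimately show ?thesis unfolding good_def by blast
  qed simp
  have "finite (A x \<inter> A y)"
    if xy: "x \<in> Field r" "y \<in> Field r" "(x, y) \<notin> r" "(y, x) \<notin> r" for x y
  proof -
    \<comment> \<open>\<open>x'\<close> is the first node towards \<open>x\<close> that is not below
      \<open>y\<close>. It has the same predecessors as its counterpart \<open>y'\<close>, so the
      two are siblings and receive disjoint sets.\<close>
    have branch: "\<exists>x'. (x', x) \<in> r \<and> (x', y) \<notin> r \<and> (\<forall>z\<in>underS r x'. (z, y) \<in> r)"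
      if "x \<in> Field r" "(x, y) \<notin> r" for x y
    proof -
      have "x \<in> {z. (z, x) \<in> r \<and> (z, y) \<notin> r}" using that refl by blast
      from wfE_min[OF wf_strict this] obtain x' where x': "(x', x) \<in> r" "(x', y) \<notin> r"
        "\<And>u. (u, x') \<in> r - Id \<Longrightarrow> u \<notin> {z. (z, x) \<in> r \<and> (z, y) \<notin> r}"
        by blast
      have "(z, y) \<in> r" if "z \<in> underS r x'" for z
        using that x' trans unfolding underS_def by blast
      with x' show ?thesis by blast
    qed
    obtain x' where x': "(x', x) \<in> r" "(x', y) \<notin> r" "\<And>z. z \<in> underS r x' \<Longrightarrow> (z, y) \<in> r"
      using branch[OF xy(1,3)] by blast
    obtain y' where y': "(y', y) \<in> r" "(y', x) \<notin> r" "\<And>z. z \<in> underS r y' \<Longrightarrow> (z, x) \<in> r"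
      using branch[OF xy(2,4)] by blast
    have "z \<in> underS r y'" if z: "z \<in> underS r x'" for z
    proof -
      have zx: "(z, x) \<in> r" using z x'(1) trans unfolding underS_def by blast
      have "(z, y') \<in> r \<or> (y', z) \<in> r" by (rule linear_below[OF x'(3)[OF z] y'(1)])
      then have "(z, y') \<in> r" "z \<noteq> y'" using y'(2) zx trans by blast+
      then show ?thesis unfolding underS_def by blast
    qed
    moreover have "z \<in> underS r x'" if z: "z \<in> underS r y'" for z
    proof -
      have zy: "(z, y) \<in> r" using z y'(1) trans unfolding underS_def by blast
      have "(z, x') \<in> r \<or> (x', z) \<in> r" by (rule linear_below[OF y'(3)[OF z] x'(1)])
      then have "(z, x') \<in> r" "z \<noteq> x'" using x'(2) zy trans by blast+
      then show ?thesis unfolding underS_def by blast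
    qed
    ultimately have eq: "underS r x' = underS r y'" by blast
    have ne: "x' \<noteq> y'" using x'(2) y'(1) by blast
    have F': "x' \<in> Field r" "y' \<in> Field r" using x'(1) y'(1) by (auto intro: FieldI1)
    have "good A x' = good A y'"
      unfolding good_def eq ht_cong[OF eq] ..
    then have B_eq: "B x' = B y'" unfolding B_def by simp
    have sib_eq: "sib x' = sib y'" unfolding sib_def eq ..
    have "x' \<in> sib y'" "y' \<in> sib y'" using F' eq unfolding sib_def by auto
    then have "to_nat_on (sib y') x' \<noteq> to_nat_on (sib y') y'"
      using ne inj_on_to_nat_on[OF sib_countable] unfolding inj_on_def by blast
    moreover have "infinite (B y')" using good F' unfolding good_def by blast
    ultimately have "A x' \<inter> A y' = {}"
      unfolding A_B B_eq sib_eq by (intro split_set_disjoint)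
    then have "A x \<inter> A y \<subseteq> (A x - A x') \<union> (A y - A y')" by blast
    then show ?thesis
      using dec[OF x'(1)] dec[OF y'(1)] finite_subset finite_UnI by metis
  qed
  moreover have "infinite (A x) \<and> A x \<in> Q (ht x)" if "x \<in> Field r" for x
    using A_good good that unfolding good_def by blast
  ultimately show ?thesis using dec by blast
qed

section \<open>The ideal of a tower\<close>

text \<open>The last two assumptions are the form in which CH enters: \<open>A_decides\<close>
  yields closure under unions, \<open>A_sparse\<close> the diagonalization for
  semiselectivity.\<close>

locale suslin_tower = suslin r for r :: "'a rel" +
  fixes A :: "'a \<Rightarrow> nat set"
  assumes infinite_A: "x \<in> Field r \<Longrightarrow> infinite (A x)"
    and A_decreasing: "(x, y) \<in> r \<Longrightarrow> finite (A y - A x)"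
    and A_almost_disjoint:
      "x \<in> Field r \<Longrightarrow> y \<in> Field r \<Longrightarrow> (x, y) \<notin> r \<Longrightarrow> (y, x) \<notin> r \<Longrightarrow> finite (A x \<inter> A y)"
    and A_decides:
      "x \<in> big \<Longrightarrow> \<exists>y\<in>big. (x, y) \<in> r \<and> (finite (A y - X) \<or> finite (A y \<inter> X))"
    and A_sparse:
      "x \<in> big \<Longrightarrow> \<exists>y\<in>big. (x, y) \<in> r \<and> finite {m \<in> A y. \<exists>n\<in>A y. m < n \<and> n \<le> f m}"
begin

definition tower_ideal :: "nat set set" where
  "tower_ideal = {X. \<forall>t\<in>big. infinite (A t - X)}"

lemma coideal_tower_ideal: "X \<in> coideal tower_ideal \<longleftrightarrow> (\<exists>t\<in>big. finite (A t - X))"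
  unfolding coideal_def tower_ideal_def by blast

lemma A_in_coideal: "t \<in> big \<Longrightarrow> finite (A t - X) \<Longrightarrow> X \<in> coideal tower_ideal"
  using coideal_tower_ideal by blast

lemma coideal_infinite:
  assumes "X \<in> coideal tower_ideal"
  shows "infinite X"
proof -
  obtain t where "t \<in> big" "finite (A t - X)" using assms coideal_tower_ideal by blast
  then show ?thesis using infinite_A[OF big_Field] by (metis Diff_infinite_finite)
qed

lemma omega_ideal_tower_ideal: "omega_ideal tower_ideal"
  unfolding omega_ideal_def
proof (intro conjI allI impI)
  show "UNIV \<notin> tower_ideal" using big_nonempty unfolding tower_ideal_def by auto
  show "F \<in> tower_ideal" if "finite F" for F
    using coideal_infinite[of F] that unfolding coideal_def by blast
  show "X \<in> tower_ideal" if "Y \<in> tower_ideal" "X \<subseteq> Y" for X Y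
    using that unfolding tower_ideal_def by (auto dest: finite_subset[rotated] simp: Diff_mono)
  show "X \<union> Y \<in> tower_ideal" if XY: "X \<in> tower_ideal" "Y \<in> tower_ideal" for X Y
  proof (rule ccontr)
    assume "X \<union> Y \<notin> tower_ideal"
    then obtain t where t: "t \<in> big" "finite (A t - (X \<union> Y))" unfolding tower_ideal_def by blast
    \<comment> \<open>A node deciding \<open>X\<close> is almost inside \<open>X\<close>, which is
      excluded, or almost disjoint from \<open>X\<close> and therefore almost inside
      \<open>Y\<close>.\<close>
    obtain u where u: "u \<in> big" "(t, u) \<in> r" "finite (A u - X) \<or> finite (A u \<inter> X)"
      using A_decides[OF t(1)] by blast
    then have "finite (A u \<inter> X)" using XY(1) unfolding tower_ideal_def by blast
    moreover have "finite (A u - (X \<union> Y))"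
      by (rule almost_subset_trans[OF A_decreasing[OF u(2)] t(2)])
    moreover have "A u - Y \<subseteq> (A u \<inter> X) \<union> (A u - (X \<union> Y))" by blast
    ultimately have "finite (A u - Y)" using finite_subset finite_UnI by metis
    then show False using XY(2) u(1) unfolding tower_ideal_def by blast
  qed
qed

lemma comparable_if_infinite_inter:
  "x \<in> Field r \<Longrightarrow> y \<in> Field r \<Longrightarrow> infinite (A x \<inter> A y) \<Longrightarrow> (x, y) \<in> r \<or> (y, x) \<in> r"
  using A_almost_disjoint by blast

section \<open>Semiselectivity of the ideal\<close>

text \<open>Turns density in the coideal into density in the tree: a member of \<open>D\<close>
  inside \<open>A t\<close> almost contains some \<open>A v\<close>, and almost disjointness makes
  \<open>v\<close> comparable with \<open>t\<close>. Since \<open>D\<close> is open only under true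
  inclusion, an initial segment \<open>{..k}\<close> is removed.\<close>

lemma dense_open_met:
  assumes D: "dense_open tower_ideal D" and t: "t \<in> big"
  shows "\<exists>u\<in>big. (t, u) \<in> r \<and> (\<exists>k. A u - {..k} \<in> D)"
proof -
  have "A t \<in> coideal tower_ideal" by (rule A_in_coideal[OF t]) simp
  then obtain M where M: "M \<in> D" "M \<subseteq> A t" "M \<in> coideal tower_ideal"
    using D unfolding dense_open_def by blast
  then obtain v where v: "v \<in> big" "finite (A v - M)" using coideal_tower_ideal by blast
  have "infinite (A v \<inter> M)"
    using infinite_almost_subset[OF infinite_A[OF big_Field[OF v(1)]] v(2)] .
  then have "infinite (A t \<inter> A v)"
    using M(2) by (meson Int_greatest Int_lower1 Int_lower2 finite_subset order_trans)
  then have cmp: "(t, v) \<in> r \<or> (v, t) \<in> r"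
    using comparable_if_infinite_inter t v(1) big_Field by blast
  have "\<exists>u\<in>big. (t, u) \<in> r \<and> (v, u) \<in> r"
    using cmp t v(1) refl big_Field by blast
  then obtain u where u: "u \<in> big" "(t, u) \<in> r" "(v, u) \<in> r" by blast
  have "finite (A u - M)" by (rule almost_subset_trans[OF A_decreasing[OF u(3)] v(2)])
  then obtain k where k: "\<forall>n\<in>A u - M. n \<le> k" using finite_imp_bounded by blast
  have "A u - (A u - {..k}) \<subseteq> {..k}" by blast
  then have "A u - {..k} \<in> coideal tower_ideal"
    using A_in_coideal[OF u(1)] finite_subset finite_atMost by metis
  moreover have "A u - {..k} \<subseteq> M" using k by auto
  ultimately have "A u - {..k} \<in> D" using D M(1) unfolding dense_open_def by blast
  then show ?thesis using u by blast
qed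

lemma semiselective_tower_ideal: "semiselective tower_ideal"
  unfolding semiselective_def
proof (intro conjI ballI allI impI)
  show "omega_ideal tower_ideal" by (rule omega_ideal_tower_ideal)
  fix X and D :: "nat \<Rightarrow> nat set set"
  assume X: "X \<in> coideal tower_ideal" and D: "\<forall>n. dense_open tower_ideal (D n)"
  obtain t where t: "t \<in> big" "finite (A t - X)" using X coideal_tower_ideal by blast
  \<comment> \<open>The traces of the \<open>D n\<close> on the tree are dense and open, so
    distributivity puts one node into all of them.\<close>
  define E where "E n = {u \<in> big. \<exists>k. A u - {..k} \<in> D n}" for n
  have "\<exists>u\<in>big. (t, u) \<in> r \<and> (\<forall>n. u \<in> E n)"
  proof (rule big_distributive[OF t(1)])
    show "\<exists>v\<in>E n \<inter> big. (u, v) \<in> r" if "u \<in> big" for n u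
      using dense_open_met[OF _ that, of "D n"] D unfolding E_def by blast
    fix n u v assume uv: "u \<in> E n" "v \<in> big" "(u, v) \<in> r"
    then obtain k where k: "A u - {..k} \<in> D n" unfolding E_def by blast
    \<comment> \<open>\<open>k\<close> suffices for \<open>u\<close>, and \<open>l\<close> absorbs
      the finitely many elements of \<open>A v\<close> outside \<open>A u\<close>.\<close>
    obtain l where l: "\<forall>m\<in>A v - A u. m \<le> l"
      using finite_imp_bounded[OF A_decreasing[OF uv(3)]] by blast
    have "A v - (A v - {..max k l}) \<subseteq> {..max k l}" by blast
    then have "A v - {..max k l} \<in> coideal tower_ideal"
      using A_in_coideal[OF uv(2)] finite_subset finite_atMost by metis
    moreover have "A v - {..max k l} \<subseteq> A u - {..k}"
      using l by (fastforce simp: max_def split: if_splits)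
    ultimately have "A v - {..max k l} \<in> D n"
      using D k unfolding dense_open_def by blast
    then show "v \<in> E n" using uv(2) unfolding E_def by blast
  qed
  then obtain u where u: "u \<in> big" "(t, u) \<in> r" "\<forall>n. \<exists>k. A u - {..k} \<in> D n"
    unfolding E_def by blast
  \<comment> \<open>\<open>f\<close> records how much of \<open>A u\<close> must be removed for each
    \<open>D n\<close>; sparseness with respect to \<open>f\<close> removes it automatically in the
    tail above \<open>n\<close>.\<close>
  from u(3) obtain f where f: "\<And>n. A u - {..f n} \<in> D n" by metis
  obtain v where v: "v \<in> big" "(u, v) \<in> r"
    and sparse: "finite {m \<in> A v. \<exists>n\<in>A v. m < n \<and> n \<le> f m}"
    using A_sparse[OF u(1)] by blast
  have "finite (A v - X)"
    using almost_subset_trans A_decreasing v(2) u(2) t(2) by metis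
  \<comment> \<open>\<open>p\<close> bounds all exceptions at once: elements outside
    \<open>X\<close>, elements outside \<open>A u\<close>, and failures of sparseness.\<close>
  then have "finite ((A v - X) \<union> (A v - A u) \<union> {m \<in> A v. \<exists>n\<in>A v. m < n \<and> n \<le> f m})"
    using A_decreasing[OF v(2)] sparse by blast
  from finite_imp_bounded[OF this] obtain p where
    p: "\<And>m. m \<in> A v \<Longrightarrow> p < m \<Longrightarrow> m \<in> X \<and> m \<in> A u"
      "\<And>m n. m \<in> A v \<Longrightarrow> p < m \<Longrightarrow> n \<in> A v \<Longrightarrow> m < n \<Longrightarrow> f m < n"
    by (fastforce simp: not_le[symmetric])
  define S where "S = A v - {..p}"
  have "S \<subseteq> X" using p(1) unfolding S_def by (metis DiffD1 DiffD2 atMost_iff not_le subsetI)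
  have tail: "tail_above S m \<in> coideal tower_ideal" for m
  proof -
    have "A v - tail_above S m \<subseteq> {..max p m}" unfolding tail_above_def S_def by auto
    then show ?thesis using A_in_coideal[OF v(1)] finite_subset finite_atMost by metis
  qed
  have "tail_above S m \<in> D m" if "m \<in> S" for m
  proof -
    have "tail_above S m \<subseteq> A u - {..f m}"
      using p that unfolding tail_above_def S_def by fastforce
    then show ?thesis using D f tail unfolding dense_open_def by blast
  qed
  moreover have "S \<in> coideal tower_ideal"
    by (rule A_in_coideal[OF v(1)]) (auto simp: S_def intro: finite_subset[of _ "{..p}"])
  ultimately show "\<exists>S\<in>coideal_restr tower_ideal X. \<forall>m\<in>S. tail_above S m \<in> D m"
    using \<open>S \<subseteq> X\<close> unfolding coideal_restr_def by blast
qed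

section \<open>No selective ultrafilter inside the coideal\<close>

text \<open>Colour each number by the first set of the level containing it. If no set of the level
  is in \<open>U\<close>, no colour class is, so selectivity gives a member of \<open>U\<close> on
  which the colouring is injective. That member meets some \<open>A t\<close> infinitely, but only
  finitely many colours occur on \<open>A t\<close>.\<close>

lemma selective_ultrafilter_meets_level:
  assumes U: "selective_ultrafilter U" "U \<subseteq> coideal tower_ideal" and a: "a \<in> Field omega1"
  shows "\<exists>t\<in>Field r. ht t = a \<and> A t \<in> U"
proof (rule ccontr)
  assume no: "\<not> ?thesis"
  define L where "L = {t \<in> Field r. ht t = a}"
  have L: "countable L" unfolding L_def by (rule countable_level)
  \<comment> \<open>Colour \<open>0\<close> is reserved for numbers in no set of the level;
    \<open>Suc\<close> shifts the genuine indices.\<close>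
  define c where "c n = (if \<exists>t\<in>L. n \<in> A t
    then Suc (LEAST k. \<exists>t\<in>L. to_nat_on L t = k \<and> n \<in> A t) else 0)" for n
  define P where "P = range (\<lambda>v. c -` {v}) - {{}}"
  \<comment> \<open>Above a node \<open>s\<close> with \<open>A s\<close> almost inside
    \<open>Y\<close> some \<open>u\<close> reaches past level \<open>a\<close>; \<open>A u\<close>
    is almost inside both \<open>Y\<close> and \<open>A t\<close>.\<close>
  have refine: "\<exists>t\<in>L. infinite (Y \<inter> A t)" if Y: "Y \<in> U" for Y
  proof -
    obtain s where s: "s \<in> big" "finite (A s - Y)" using Y U(2) coideal_tower_ideal by blast
    obtain u t where u: "u \<in> big" "(s, u) \<in> r" "(t, u) \<in> r" "ht t = a"
      using big_extension_to_level[OF s(1) a] by blast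
    have "finite (A u - Y)" by (rule almost_subset_trans[OF A_decreasing[OF u(2)] s(2)])
    moreover have "finite (A u - A t)" by (rule A_decreasing[OF u(3)])
    ultimately have "finite (A u - Y \<inter> A t)" by (simp add: Diff_Int)
    then have "infinite (Y \<inter> A t)"
      using infinite_A[OF big_Field[OF u(1)]] by (metis Diff_infinite_finite)
    moreover have "t \<in> L" unfolding L_def using u FieldI1 by fastforce
    ultimately show ?thesis by blast
  qed
  have uf: "omega_ultrafilter U"
    using U(1) unfolding selective_ultrafilter_def by (rule conjunct1)
  have upward: "Y \<in> U" if "X \<in> U" "X \<subseteq> Y" for X Y
    using uf that unfolding omega_ultrafilter_def by meson
  have "c -` {v} \<notin> U" for v
  proof
    assume v: "c -` {v} \<in> U"
    show False
    proof (cases v)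
      case 0
      from refine[OF v] obtain t where t: "t \<in> L" "infinite (c -` {v} \<inter> A t)" by blast
      moreover have "c -` {v} \<inter> A t = {}" using t(1) 0 unfolding c_def by (auto split: if_splits)
      ultimately show False by simp
    next
      case (Suc k)
      have mem: "\<exists>t\<in>L. to_nat_on L t = k \<and> n \<in> A t" if "n \<in> c -` {v}" for n
      proof -
        have ex: "\<exists>t\<in>L. n \<in> A t" and k: "k = (LEAST k. \<exists>t\<in>L. to_nat_on L t = k \<and> n \<in> A t)"
          using that Suc unfolding c_def by (auto split: if_splits)
        from ex have "\<exists>k. \<exists>t\<in>L. to_nat_on L t = k \<and> n \<in> A t" by blast
        from LeastI_ex[OF this] show ?thesis unfolding k .
      qed
      have "c -` {v} \<noteq> {}"
        using v uf unfolding omega_ultrafilter_def by metis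
      then obtain t where t: "t \<in> L" "to_nat_on L t = k" using mem by blast
      then have "c -` {v} \<subseteq> A t"
        using mem inj_on_to_nat_on[OF L] unfolding inj_on_def by blast
      then have "A t \<in> U" using upward v by blast
      then show False using no t(1) unfolding L_def by blast
    qed
  qed
  then have "P \<inter> U = {}" unfolding P_def by blast
  moreover have "partition_on UNIV P"
    unfolding P_def by (rule partition_onI) (auto simp: disjnt_def)
  ultimately obtain S where S: "S \<in> U" "\<And>p x y. p \<in> P \<Longrightarrow> x \<in> S \<inter> p \<Longrightarrow> y \<in> S \<inter> p \<Longrightarrow> x = y"
    using U(1) unfolding selective_ultrafilter_def by metis
  obtain t where t: "t \<in> L" "infinite (S \<inter> A t)" using refine[OF S(1)] by blast
  have "inj_on c (S \<inter> A t)"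
  proof (rule inj_onI)
    fix x y assume xy: "x \<in> S \<inter> A t" "y \<in> S \<inter> A t" "c x = c y"
    then show "x = y"
      using S(2)[of "c -` {c x}" x y] unfolding P_def by auto
  qed
  moreover have "c ` (S \<inter> A t) \<subseteq> {..Suc (to_nat_on L t)}"
    using t(1) by (auto simp: c_def intro: Least_le)
  ultimately show False
    using t(2) finite_subset finite_atMost finite_imageD by metis
qed

text \<open>Intersections of members of \<open>U\<close> are infinite, so almost disjointness forces
  the nodes chosen on different levels to be comparable.\<close>

lemma no_selective_ultrafilter:
  assumes U: "selective_ultrafilter U" "U \<subseteq> coideal tower_ideal"
  shows False
proof -
  have uf: "omega_ultrafilter U"
    using U(1) unfolding selective_ultrafilter_def by (rule conjunct1)
  from selective_ultrafilter_meets_level[OF U] obtain t where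
    t: "\<And>a. a \<in> Field omega1 \<Longrightarrow> t a \<in> Field r \<and> ht (t a) = a \<and> A (t a) \<in> U"
    by metis
  have "t ` Field omega1 \<in> Chains r"
  proof -
    have "(t a, t b) \<in> r \<or> (t b, t a) \<in> r" if "a \<in> Field omega1" "b \<in> Field omega1" for a b
    proof -
      have "A (t a) \<inter> A (t b) \<in> U"
        using t that uf unfolding omega_ultrafilter_def by meson
      then have "infinite (A (t a) \<inter> A (t b))" using U(2) coideal_infinite by blast
      then show ?thesis using comparable_if_infinite_inter t that by blast
    qed
    then show ?thesis unfolding Chains_def by blast
  qed
  then have "countable (t ` Field omega1)" by (rule countable_chain)
  moreover have "inj_on t (Field omega1)" using t by (metis inj_onI)
  ultimately have "countable (Field omega1)" by (rule countable_image_inj_on)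
  then show False using uncountable_Field_omega1 by blast
qed

end

section \<open>Requirements and the construction under CH\<close>

text \<open>Under CH the sets of naturals can be listed along the levels of the tree, so one set
  \<open>i\<close> is made to encode both a set to be decided, namely \<open>i\<close> itself, and a function.\<close>

definition decoded_fun :: "nat set \<Rightarrow> nat \<Rightarrow> nat" where
  "decoded_fun i n = (LEAST k. prod_encode (n, k) \<in> i)"

lemma decoded_fun_surj: "\<exists>i. decoded_fun i = f"
proof
  show "decoded_fun {prod_encode (n, f n) | n. True} = f"
    unfolding decoded_fun_def by (rule ext, rule Least_equality) auto
qed

text \<open>Both clauses tolerate finitely many exceptions, which makes them stable under almost
  inclusion.\<close>

definition requirement :: "nat set \<Rightarrow> nat set set" where
  "requirement i = {B. (finite (B - i) \<or> finite (B \<inter> i)) \<and>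
     finite {m \<in> B. \<exists>n\<in>B. m < n \<and> n \<le> decoded_fun i m}}"

text \<open>As \<open>f\<close> need not be monotone, each new element is chosen above the maximum
  of \<open>f\<close> on the whole initial segment up to the previous one.\<close>

lemma sparse_subset:
  fixes f :: "nat \<Rightarrow> nat"
  assumes "infinite B"
  shows "\<exists>C. infinite C \<and> C \<subseteq> B \<and> (\<forall>m\<in>C. \<forall>n\<in>C. m < n \<longrightarrow> f m < n)"
proof -
  have "\<exists>c. \<forall>n. c n \<in> B \<and> (c n < c (Suc n) \<and> (\<forall>m\<le>c n. f m < c (Suc n)))"
  proof (rule dependent_nat_choice)
    show "\<exists>x. x \<in> B" using assms by (metis ex_in_conv finite.emptyI)
    fix x :: nat and n :: nat
    obtain y where "y \<in> B" "max x (Max (f ` {..x})) < y"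
      using assms unfolding infinite_nat_iff_unbounded by blast
    moreover have "f m \<le> Max (f ` {..x})" if "m \<le> x" for m
      using that by (intro Max_ge) auto
    ultimately show "\<exists>y. y \<in> B \<and> x < y \<and> (\<forall>m\<le>x. f m < y)"
      by (metis le_less_trans max_less_iff_conj)
  qed
  then obtain c where c: "\<And>n. c n \<in> B" "\<And>n. c n < c (Suc n)" "\<And>n m. m \<le> c n \<Longrightarrow> f m < c (Suc n)"
    by blast
  have mono: "strict_mono c" using c(2) by (simp add: strict_mono_Suc_iff)
  have "f (c i) < c j" if "c i < c j" for i j
  proof -
    have "i < j" using that strict_mono_less[OF mono] by blast
    then obtain k where k: "j = Suc k" "i \<le> k"
      by (metis Suc_leI less_Suc_eq_le not0_implies_Suc not_less_zero)
    then show ?thesis using c(3)[of "c i" k] strict_mono_less_eq[OF mono] by blast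
  qed
  moreover have "infinite (range c)"
    using mono range_inj_infinite strict_mono_imp_inj_on by blast
  ultimately show ?thesis using c(1) by (intro exI[of _ "range c"]) auto
qed

lemma almost_dense_open_requirement: "almost_dense_open (requirement i)"
  unfolding almost_dense_open_def
proof (intro conjI allI impI ballI)
  fix B :: "nat set" assume B: "infinite B"
  then have "\<exists>C. infinite C \<and> C \<subseteq> B \<and> (finite (C - i) \<or> finite (C \<inter> i))"
  proof (cases "infinite (B \<inter> i)")
    case True
    moreover have "B \<inter> i - i = {}" by blast
    ultimately show ?thesis by (metis finite.emptyI inf_le1)
  qed blast
  then obtain C where C: "infinite C" "C \<subseteq> B" "finite (C - i) \<or> finite (C \<inter> i)" by blast
  obtain D where D: "infinite D" "D \<subseteq> C" "\<forall>m\<in>D. \<forall>n\<in>D. m < n \<longrightarrow> decoded_fun i m < n"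
    using sparse_subset[OF C(1)] by blast
  have "D - i \<subseteq> C - i" "D \<inter> i \<subseteq> C \<inter> i" using D(2) by auto
  then have "finite (D - i) \<or> finite (D \<inter> i)" using C(3) finite_subset by metis
  moreover have "{m \<in> D. \<exists>n\<in>D. m < n \<and> n \<le> decoded_fun i m} = {}"
    using D(3) by (auto simp: not_le[symmetric])
  then have "finite {m \<in> D. \<exists>n\<in>D. m < n \<and> n \<le> decoded_fun i m}"
    by (simp only: finite.emptyI)
  ultimately have "D \<in> requirement i" unfolding requirement_def by blast
  then show "\<exists>C\<in>requirement i. infinite C \<and> C \<subseteq> B" using C(2) D by blast
next
  fix B C :: "nat set" assume B: "B \<in> requirement i" and CB: "finite (C - B)"
  let ?bad = "\<lambda>B. {m \<in> B. \<exists>n\<in>B. m < n \<and> n \<le> decoded_fun i m}"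
  have "C - i \<subseteq> (C - B) \<union> (B - i)" "C \<inter> i \<subseteq> (C - B) \<union> (B \<inter> i)" by blast+
  then have "finite (C - i) \<or> finite (C \<inter> i)"
    using B CB unfolding requirement_def by (auto dest: finite_subset)
  \<comment> \<open>A failure \<open>m\<close> in \<open>C\<close> that is not one in
    \<open>B\<close> has \<open>m\<close> or its witness \<open>n\<close> in \<open>C - B\<close>,
    so \<open>m\<close> is at most some element of that finite set.\<close>
  moreover have "?bad C \<subseteq> ?bad B \<union> (\<Union>n\<in>C - B. {..n})"
    by auto
  then have "finite (?bad C)"
    using B CB finite_subset unfolding requirement_def by blast
  ultimately show "C \<in> requirement i" unfolding requirement_def by blast
qed

lemma continuum_hypothesis_enumeration:
  assumes "continuum_hypothesis"
  shows "\<exists>e. e ` Field omega1 = (UNIV :: nat set set)"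
proof -
  have "|Field omega1| =o |UNIV :: nat set set|"
    using assms card_of_Field_ordIso[OF Card_order_omega1] ordIso_symmetric ordIso_transitive
    unfolding continuum_hypothesis_def by blast
  then show ?thesis
    unfolding card_of_ordIso[symmetric] bij_betw_def by blast
qed

theorem theorem5p2:
  assumes "continuum_hypothesis"
    and "\<exists>r :: 'a rel. suslin_tree r"
  shows "\<exists>I. semiselective I \<and> (\<nexists>U. selective_ultrafilter U \<and> U \<subseteq> coideal I)"
proof -
  obtain r :: "'a rel" where "suslin_tree r" using assms(2) by blast
  then interpret suslin r by unfold_locales
  obtain e where e: "e ` Field omega1 = (UNIV :: nat set set)"
    using continuum_hypothesis_enumeration[OF assms(1)] by blast
  obtain A where A: "\<And>x. x \<in> Field r \<Longrightarrow> infinite (A x) \<and> A x \<in> requirement (e (ht x))"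
    "\<And>x y. (x, y) \<in> r \<Longrightarrow> finite (A y - A x)"
    "\<And>x y. x \<in> Field r \<Longrightarrow> y \<in> Field r \<Longrightarrow> (x, y) \<notin> r \<Longrightarrow> (y, x) \<notin> r \<Longrightarrow> finite (A x \<inter> A y)"
    using tower_exists[of "\<lambda>a. requirement (e a)"] almost_dense_open_requirement by blast
  \<comment> \<open>The level \<open>a\<close> with \<open>e a = i\<close> handles \<open>i\<close>;
    openness carries the requirement from its node \<open>z\<close> up to \<open>y\<close>.\<close>
  have met: "\<exists>y\<in>big. (x, y) \<in> r \<and> A y \<in> requirement i" if x: "x \<in> big" for x i
  proof -
    obtain a where a: "a \<in> Field omega1" "e a = i" using e by (metis UNIV_I imageE)
    obtain y z where y: "y \<in> big" "(x, y) \<in> r" "(z, y) \<in> r" "ht z = a"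
      using big_extension_to_level[OF x a(1)] by blast
    have "A z \<in> requirement i" using A(1)[OF FieldI1[OF y(3)]] y(4) a(2) by simp
    then have "A y \<in> requirement i"
      using A(2)[OF y(3)] almost_dense_open_requirement[of i] unfolding almost_dense_open_def
      by blast
    then show ?thesis using y by blast
  qed
  \<comment> \<open>Deciding \<open>X\<close> uses the requirement of \<open>X\<close> itself,
    sparseness for \<open>f\<close> that of a set decoding to \<open>f\<close>.\<close>
  interpret suslin_tower r A
  proof
    show "\<exists>y\<in>big. (x, y) \<in> r \<and> (finite (A y - X) \<or> finite (A y \<inter> X))" if "x \<in> big" for x X
      using met[OF that, of X] unfolding requirement_def by blast
    show "\<exists>y\<in>big. (x, y) \<in> r \<and> finite {m \<in> A y. \<exists>n\<in>A y. m < n \<and> n \<le> f m}"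
      if "x \<in> big" for x f
    proof -
      obtain i where "decoded_fun i = f" using decoded_fun_surj by blast
      then show ?thesis using met[OF that, of i] unfolding requirement_def by blast
    qed
  qed (use A in blast)+
  show ?thesis using semiselective_tower_ideal no_selective_ultrafilter by blast
qed

end
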